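(* Let $\mathbb{H}$ be an $n$-dimensional real Hilbert space with orthonormal basis $\{v_i\}_{i=1}^n$, and let $L:\mathbb{H}\to\mathbb{H}$ be a linear operator with $\|Lv_i\|=1$ for all $i=1,\dots,n$. Let $0\le m\le n$ and let $$A=\sum_{i=1}^m (Lv_i)(Lv_i)^T .$$ Let $b\in\mathbb{R}$ and $\delta>0$, and put $b'=b-\delta$. Assume that $b'>\delta$, and that $A$ has exactly $m$ non-zero eigenvalues (counted with multiplicity), all of which are greater than $b$. If $$\operatorname{Tr}\left[L^T(A-bI)^{-1}L\right]\le -n-\frac{2\|L\|^2}{\delta},$$ then there exists a vector $\omega\in\{Lv_i\}_{i=1}^n$ satisfying both of the following: (1) $\omega^T(A-b'I)^{-1}\omega<-1$, and hence $\omega=Lv_j$ for some $m<j\le n$; (2) $\operatorname{Tr}\left[L^T(A+\omega\omega^T-b'I)^{-1}L\right]\le \operatorname{Tr}\left[L^T(A-bI)^{-1}L\right]\le -n-\dfrac{2\|L\|^2}{\delta}.$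
   Context: Vectors of $\mathbb{H}$ are identified with column vectors in $\mathbb{R}^n$ via the orthonormal basis and operators with $n\times n$ real matrices; $T$ denotes transpose, so for a vector $w$, $ww^T$ is the rank-one operator $x\mapsto \langle x,w\rangle w$ and $w^TMw=\langle Mw,w\rangle$. $I$ is the identity, $\operatorname{Tr}$ the trace, and $\|L\|$ the operator norm of $L$. An empty sum (when $m=0$) is $0$. *)

theory Defs
  imports
    "HOL-Analysis.Analysis"
    "Jordan_Normal_Form.Char_Poly"
begin

definition orthonormal_basis :: "nat \<Rightarrow> (nat \<Rightarrow> 'a::euclidean_space) \<Rightarrow> bool" where
  "orthonormal_basis n v \<longleftrightarrow>
     (\<forall>i\<in>{1..n}. \<forall>j\<in>{1..n}. inner (v i) (v j) = (if i = j then 1 else 0)) \<and>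
     span (v ` {1..n}) = UNIV"

text \<open>Vectors of the basis are numbered from 1, rows and columns of a matrix from 0.\<close>

definition op_matrix :: "nat \<Rightarrow> (nat \<Rightarrow> 'a::euclidean_space) \<Rightarrow> ('a \<Rightarrow> 'a) \<Rightarrow> real Matrix.mat" where
  "op_matrix n v M = Matrix.mat n n (\<lambda>(i, j). inner (v (Suc i)) (M (v (Suc j))))"

definition op_trace :: "nat \<Rightarrow> (nat \<Rightarrow> 'a::euclidean_space) \<Rightarrow> ('a \<Rightarrow> 'a) \<Rightarrow> real" where
  "op_trace n v M = (\<Sum>i<n. op_matrix n v M $$ (i, i))"

text \<open>The real roots of the characteristic polynomial, repeated according to their
  multiplicity. For a self-adjoint operator these are all of its complex roots.\<close>

definition op_eigenvalues :: "nat \<Rightarrow> (nat \<Rightarrow> 'a::euclidean_space) \<Rightarrow> ('a \<Rightarrow> 'a) \<Rightarrow> real multiset" where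
  "op_eigenvalues n v M = proots (char_poly (op_matrix n v M))"

text \<open>The operator \<open>w w\<^sup>T\<close>.\<close>

definition rank_one :: "'a::euclidean_space \<Rightarrow> 'a \<Rightarrow> 'a" where
  "rank_one w = (\<lambda>x. inner x w *\<^sub>R w)"

text \<open>The operator \<open>M - c I\<close>.\<close>

definition op_shift :: "('a::euclidean_space \<Rightarrow> 'a) \<Rightarrow> real \<Rightarrow> 'a \<Rightarrow> 'a" where
  "op_shift M c = (\<lambda>x. M x - c *\<^sub>R x)"

end

theory Submission
  imports Defs
begin

text \<open>Write \<open>w\<^sub>i = L (v i)\<close>, \<open>M = (A - b I)\<^sup>-\<^sup>1\<close> and \<open>N = (A - b' I)\<^sup>-\<^sup>1\<close>. By the Sherman--Morrison
  formula, adding \<open>w w\<^sup>T\<close> to \<open>A\<close> changes \<open>Tr[L\<^sup>T N L]\<close> by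
  \<open>\<parallel>L\<^sup>T N w\<parallel>\<^sup>2 / (- 1 - \<langle>N w, w\<rangle>)\<close>, while moving the shift from \<open>b\<close> to \<open>b'\<close> lowers the trace by some
  \<open>\<Delta> = \<Sum>i. \<langle>(M - N) w\<^sub>i, w\<^sub>i\<rangle>\<close>. So it is enough to find an index \<open>i\<close> with
  \<open>\<parallel>L\<^sup>T N w\<^sub>i\<parallel>\<^sup>2 < \<Delta> (- 1 - \<langle>N w\<^sub>i, w\<^sub>i\<rangle>)\<close>; as \<open>\<Delta> > 0\<close>, the same inequality also forces
  \<open>\<langle>N w\<^sub>i, w\<^sub>i\<rangle> < - 1\<close>.

  Such an index exists because the inequality holds after summation over \<open>i\<close>. The left-hand sides
  add up to at most \<open>\<parallel>L\<parallel>\<^sup>2 \<Sum>i. \<parallel>N w\<^sub>i\<parallel>\<^sup>2\<close>, and \<open>N\<^sup>2 \<le> (2 / \<delta>) (M - N)\<close> bounds this by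
  \<open>\<Delta> (2 \<parallel>L\<parallel>\<^sup>2 / \<delta>)\<close>. The right-hand sides add up to \<open>\<Delta> (- n - Tr[L\<^sup>T N L])\<close>, which by the
  hypothesis on the trace is at least \<open>\<Delta> (2 \<parallel>L\<parallel>\<^sup>2 / \<delta> + \<Delta>)\<close>.

  The operator inequality reflects the gap in the spectrum of \<open>A\<close>: on an eigenspace for \<open>\<lambda>\<close>, the
  number \<open>(M - N) / \<delta>\<close> is \<open>1 / ((\<lambda> - b) (\<lambda> - b'))\<close>, which exceeds \<open>N\<^sup>2\<close> if \<open>\<lambda> > b\<close>, and is
  \<open>N\<^sup>2 b' / b > N\<^sup>2 / 2\<close> if \<open>\<lambda> = 0\<close>, since \<open>b' > \<delta>\<close>. The proof
  splits the space only into the kernel of \<open>A\<close> and its orthogonal complement, on which minimising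
  the Rayleigh quotient shows that \<open>A - b I\<close> is positive definite. The same splitting
  gives \<open>\<langle>N w\<^sub>j, w\<^sub>j\<rangle> \<ge> 0\<close> for \<open>j \<le> m\<close>, because these \<open>w\<^sub>j\<close> are orthogonal to the kernel; hence the
  index that was found is greater than \<open>m\<close>.\<close>

section \<open>Traces and eigenvalues in an orthonormal basis\<close>

lemma orthonormal_basis_eqI:
  assumes "orthonormal_basis n v" and "\<And>i. i \<in> {1..n} \<Longrightarrow> inner (v i) x = inner (v i) y"
  shows "x = y"
proof -
  have "Linear_Algebra.orthogonal (x - y) z" if "z \<in> v ` {1..n}" for z
    using assms(2) that by (auto simp: Linear_Algebra.orthogonal_def inner_diff_left inner_diff_right inner_commute)
  moreover have "x - y \<in> span (v ` {1..n})"
    using assms(1) by (simp add: orthonormal_basis_def)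
  ultimately have "Linear_Algebra.orthogonal (x - y) (x - y)"
    by (meson orthogonal_to_span)
  then show ?thesis by (simp add: Linear_Algebra.orthogonal_def)
qed

lemma orthonormal_basis_expansion:
  assumes "orthonormal_basis n v"
  shows "x = (\<Sum>i=1..n. inner (v i) x *\<^sub>R v i)"
proof (rule orthonormal_basis_eqI[OF assms])
  fix j assume j: "j \<in> {1..n}"
  have "inner (v j) (\<Sum>i=1..n. inner (v i) x *\<^sub>R v i) = (\<Sum>i=1..n. inner (v i) x * inner (v j) (v i))"
    by (simp add: inner_sum_right)
  also have "\<dots> = (\<Sum>i=1..n. if i = j then inner (v j) x else 0)"
    using assms j by (intro sum.cong) (auto simp: orthonormal_basis_def)
  also have "\<dots> = inner (v j) x" using j by simp
  finally show "inner (v j) x = inner (v j) (\<Sum>i=1..n. inner (v i) x *\<^sub>R v i)" by simp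
qed

lemma orthonormal_basis_parseval:
  assumes "orthonormal_basis n v"
  shows "(\<Sum>i=1..n. (inner x (v i))\<^sup>2) = (norm x)\<^sup>2"
proof -
  have "(norm x)\<^sup>2 = inner x (\<Sum>i=1..n. inner (v i) x *\<^sub>R v i)"
    using orthonormal_basis_expansion[OF assms, of x] by (simp add: power2_norm_eq_inner)
  also have "\<dots> = (\<Sum>i=1..n. (inner x (v i))\<^sup>2)"
    by (simp add: inner_sum_right power2_eq_square inner_commute)
  finally show ?thesis by simp
qed

lemma op_trace_conj:
  fixes L :: "'a::euclidean_space \<Rightarrow> 'a"
  assumes "linear L"
  shows "op_trace n v (adjoint L \<circ> M \<circ> L) = (\<Sum>i=1..n. inner (M (L (v i))) (L (v i)))"
proof -
  have "op_trace n v (adjoint L \<circ> M \<circ> L) = (\<Sum>i<n. inner (M (L (v (Suc i)))) (L (v (Suc i))))"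
    by (simp add: op_trace_def op_matrix_def adjoint_works[OF assms] inner_commute)
  also have "\<dots> = (\<Sum>i=1..n. inner (M (L (v i))) (L (v i)))"
    by (rule sum.reindex_bij_witness[of _ "\<lambda>i. i - 1" Suc]) auto
  finally show ?thesis .
qed

lemma eigenvector_imp_op_eigenvalue:
  assumes basis: "orthonormal_basis n v" and "linear A" and "u \<noteq> 0" and Au: "A u = c *\<^sub>R u"
  shows "c \<in># op_eigenvalues n v A"
proof -
  define B where "B = op_matrix n v A"
  define z where "z = Matrix.vec n (\<lambda>i. inner (v (Suc i)) u)"
  have B: "B \<in> carrier_mat n n" by (simp add: B_def op_matrix_def)
  have z: "z \<in> carrier_vec n" by (simp add: z_def)
  have nz: "z \<noteq> 0\<^sub>v n"
  proof
    assume z0: "z = 0\<^sub>v n"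
    have "u = 0"
    proof (rule orthonormal_basis_eqI[OF basis])
      fix i assume i: "i \<in> {1..n}"
      then have "i - 1 < n" by auto
      then have "z $ (i - 1) = 0" unfolding z0 by (rule index_zero_vec(1))
      with i \<open>i - 1 < n\<close> show "inner (v i) u = inner (v i) 0" by (simp add: z_def)
    qed
    with \<open>u \<noteq> 0\<close> show False by simp
  qed
  have "B *\<^sub>v z = c \<cdot>\<^sub>v z"
  proof (rule eq_vecI)
    fix i assume "i < dim_vec (c \<cdot>\<^sub>v z)"
    then have i: "i < n" by (simp add: z_def)
    have "(B *\<^sub>v z) $ i = (\<Sum>j<n. inner (v (Suc i)) (A (v (Suc j))) * inner (v (Suc j)) u)"
      using i by (simp add: B_def z_def op_matrix_def scalar_prod_def atLeast0LessThan)
    also have "\<dots> = (\<Sum>j=1..n. inner (v (Suc i)) (A (v j)) * inner (v j) u)"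
      by (rule sum.reindex_bij_witness[of _ "\<lambda>i. i - 1" Suc]) auto
    also have "\<dots> = inner (v (Suc i)) (A (\<Sum>j=1..n. inner (v j) u *\<^sub>R v j))"
      by (simp add: linear_sum[OF \<open>linear A\<close>] linear_scale[OF \<open>linear A\<close>] inner_sum_right mult.commute)
    also have "\<dots> = inner (v (Suc i)) (A u)"
      using orthonormal_basis_expansion[OF basis, of u] by simp
    finally show "(B *\<^sub>v z) $ i = (c \<cdot>\<^sub>v z) $ i" using i by (simp add: Au z_def)
  qed (simp add: B_def z_def op_matrix_def)
  with B z nz have "eigenvalue B c"
    unfolding eigenvalue_def eigenvector_def by auto
  then have "poly (char_poly B) c = 0"
    using eigenvalue_root_char_poly[OF B] by simp
  moreover have "char_poly B \<noteq> 0"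
    using degree_monic_char_poly[OF B] by auto
  ultimately show ?thesis
    by (simp add: op_eigenvalues_def B_def)
qed

lemma norm_adjoint_le:
  fixes L :: "'a::euclidean_space \<Rightarrow> 'a"
  assumes "linear L"
  shows "norm (adjoint L x) \<le> onorm L * norm x"
proof -
  let ?y = "adjoint L x"
  have "norm ?y * norm ?y = inner (L ?y) x"
    by (metis adjoint_works[OF assms] inner_commute power2_norm_eq_inner power2_eq_square)
  also have "\<dots> \<le> norm (L ?y) * norm x" by (rule norm_cauchy_schwarz)
  also have "\<dots> \<le> (onorm L * norm ?y) * norm x"
    using assms by (intro mult_right_mono onorm) (auto simp: linear_conv_bounded_linear)
  finally have "norm ?y * norm ?y \<le> norm ?y * (onorm L * norm x)" by (simp add: mult_ac)
  moreover have "0 \<le> onorm L * norm x"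
    using assms by (simp add: linear_conv_bounded_linear onorm_pos_le)
  ultimately show ?thesis
    by (cases "norm ?y = 0") (auto simp: mult_le_cancel_left)
qed

section \<open>A self-adjoint operator with a spectral gap\<close>

text \<open>The quadratic form of \<open>A\<close> attains its minimum \<open>\<mu>\<close> on the unit sphere of \<open>R\<close>. At a minimiser
  \<open>u\<close> the form \<open>\<langle>A x, x\<rangle> - \<mu> \<parallel>x\<parallel>\<^sup>2\<close>, which is nonnegative on \<open>R\<close>, vanishes; so its derivative at \<open>u\<close>
  in the direction \<open>A u - \<mu> u\<close>, which lies in \<open>R\<close>, must vanish too.\<close>

lemma invariant_subspace_min_eigenvector:
  fixes A :: "'a::euclidean_space \<Rightarrow> 'a"
  assumes lin: "linear A" and sym: "\<And>x y. inner (A x) y = inner x (A y)"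
    and R: "subspace R" and inv: "\<And>x. x \<in> R \<Longrightarrow> A x \<in> R" and ne: "x0 \<in> R" "x0 \<noteq> 0"
  obtains u \<mu> where "u \<in> R" "u \<noteq> 0" "A u = \<mu> *\<^sub>R u"
    "\<And>x. x \<in> R \<Longrightarrow> \<mu> * (norm x)\<^sup>2 \<le> inner (A x) x"
proof -
  let ?S = "sphere 0 1 \<inter> R"
  have cpt: "compact ?S"
    using R by (intro compact_Int_closed closed_subspace) auto
  have "(1 / norm x0) *\<^sub>R x0 \<in> ?S"
    using ne R by (simp add: subspace_scale)
  then have nemp: "?S \<noteq> {}" by blast
  have cont: "continuous_on ?S (\<lambda>x. inner (A x) x)"
    by (intro continuous_intros linear_continuous_on)
       (use lin in \<open>simp add: linear_conv_bounded_linear\<close>)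
  obtain u where u: "u \<in> ?S" and min: "\<And>x. x \<in> ?S \<Longrightarrow> inner (A u) u \<le> inner (A x) x"
    using continuous_attains_inf[OF cpt nemp cont] by blast
  define \<mu> where "\<mu> = inner (A u) u"
  have ge: "\<mu> * (norm x)\<^sup>2 \<le> inner (A x) x" if "x \<in> R" for x
  proof (cases "x = 0")
    case True
    then show ?thesis by (simp add: linear_0[OF lin])
  next
    case False
    let ?x = "(1 / norm x) *\<^sub>R x"
    have "?x \<in> ?S" using False that R by (simp add: subspace_scale)
    then have "\<mu> \<le> inner (A ?x) ?x" using min unfolding \<mu>_def by blast
    also have "\<dots> = inner (A x) x / (norm x)\<^sup>2"
      by (simp add: linear_scale[OF lin] power2_eq_square)
    finally show ?thesis using False by (simp add: pos_le_divide_eq)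
  qed
  define h where "h = A u - \<mu> *\<^sub>R u"
  define q where "q = inner (A h) h - \<mu> * inner h h"
  have hR: "h \<in> R"
    unfolding h_def using u R inv by (intro subspace_diff subspace_scale) auto
  have uu: "inner u u = 1" using u by (simp add: norm_eq_1)
  have quad: "2 * t * inner h h \<le> t\<^sup>2 * q" for t
  proof -
    have "u - t *\<^sub>R h \<in> R" using u hR R by (intro subspace_diff subspace_scale) auto
    then have "\<mu> * inner (u - t *\<^sub>R h) (u - t *\<^sub>R h) \<le> inner (A (u - t *\<^sub>R h)) (u - t *\<^sub>R h)"
      using ge by (simp add: power2_norm_eq_inner)
    moreover have "inner (A h) u = inner (A u) h" by (metis sym inner_commute)
    moreover have "inner (A u) h = inner h h + \<mu> * inner u h"
      by (simp add: h_def inner_diff_left)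
    moreover have "inner (A u) u = \<mu>" by (simp add: \<mu>_def)
    ultimately show ?thesis
      by (simp add: linear_diff[OF lin] linear_scale[OF lin] inner_diff_left inner_diff_right uu q_def
          power2_eq_square algebra_simps inner_commute[of h u])
  qed
  have "inner h h \<le> 0"
  proof (rule ccontr)
    assume "\<not> ?thesis"
    then have pos: "inner h h > 0" by linarith
    show False
    proof (cases "q > 0")
      case True
      from quad[of "inner h h / q"] True have "inner h h * inner h h \<le> 0"
        by (simp add: field_simps power2_eq_square)
      with mult_pos_pos[OF pos pos] show False by linarith
    next
      case False
      with quad[of 1] pos show False by simp
    qed
  qed
  then have "h = 0" by (metis inner_gt_zero_iff not_less)
  then have "A u = \<mu> *\<^sub>R u" by (simp add: h_def)
  moreover have "u \<noteq> 0" using uu by auto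
  ultimately show ?thesis using that u ge by blast
qed

text \<open>The least eigenvalue of the restriction of \<open>A\<close> to the orthogonal complement of the kernel is
  non-zero, hence above the gap.\<close>

lemma spectral_gap_ortho_kernel:
  fixes A :: "'a::euclidean_space \<Rightarrow> 'a"
  assumes lin: "linear A" and sym: "\<And>x y. inner (A x) y = inner x (A y)"
    and gap: "\<And>c u. u \<noteq> 0 \<Longrightarrow> A u = c *\<^sub>R u \<Longrightarrow> c \<noteq> 0 \<Longrightarrow> b < c"
    and orth: "\<And>k. A k = 0 \<Longrightarrow> inner k r = 0" and "r \<noteq> 0"
  shows "b * (norm r)\<^sup>2 < inner (A r) r"
proof -
  let ?R = "{x. \<forall>k. A k = 0 \<longrightarrow> inner k x = 0}"
  have sub: "subspace ?R" by (auto simp: subspace_def inner_add_right)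
  have inv: "A x \<in> ?R" for x by (auto simp flip: sym)
  obtain u \<mu> where u: "u \<in> ?R" "u \<noteq> 0" "A u = \<mu> *\<^sub>R u"
    and ge: "\<And>x. x \<in> ?R \<Longrightarrow> \<mu> * (norm x)\<^sup>2 \<le> inner (A x) x"
    using invariant_subspace_min_eigenvector[OF lin sym sub inv, of r] orth \<open>r \<noteq> 0\<close> by blast
  have "\<mu> \<noteq> 0" using u by force
  then have "b < \<mu>" using gap u by blast
  then have "b * (norm r)\<^sup>2 < \<mu> * (norm r)\<^sup>2" using \<open>r \<noteq> 0\<close> by simp
  also have "\<dots> \<le> inner (A r) r" using ge orth by simp
  finally show ?thesis .
qed

lemma spectral_gap_decomp:
  fixes A :: "'a::euclidean_space \<Rightarrow> 'a"
  assumes lin: "linear A" and sym: "\<And>x y. inner (A x) y = inner x (A y)"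
    and gap: "\<And>c u. u \<noteq> 0 \<Longrightarrow> A u = c *\<^sub>R u \<Longrightarrow> c \<noteq> 0 \<Longrightarrow> b < c"
  obtains k r where "x = k + r" "A k = 0" "\<And>z. A z = 0 \<Longrightarrow> inner z r = 0"
    "r \<noteq> 0 \<Longrightarrow> b * (norm r)\<^sup>2 < inner (A r) r"
proof -
  let ?K = "{z. A z = 0}"
  have "subspace ?K" by (rule linear_subspace_kernel[OF lin])
  then have K: "span ?K = ?K" by (simp add: span_eq_iff)
  obtain k r where *: "k \<in> span ?K" "\<And>w. w \<in> span ?K \<Longrightarrow> Linear_Algebra.orthogonal r w" "x = k + r"
    by (rule orthogonal_subspace_decomp_exists[of ?K x]) blast
  have orth: "inner z r = 0" if "A z = 0" for z
    using *(2)[of z] that K by (simp add: Linear_Algebra.orthogonal_def inner_commute)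
  show ?thesis
  proof (rule that[of k r])
    show "b * (norm r)\<^sup>2 < inner (A r) r" if "r \<noteq> 0"
      using spectral_gap_ortho_kernel[OF lin sym gap orth that] .
  qed (use * K orth in auto)
qed

lemma linear_op_shift: "linear A \<Longrightarrow> linear (op_shift A c)"
  unfolding op_shift_def by (intro linear_compose_sub linear_compose_scale_right linear_ident)

lemma bij_op_shift_spectral_gap:
  fixes A :: "'a::euclidean_space \<Rightarrow> 'a"
  assumes lin: "linear A" and sym: "\<And>x y. inner (A x) y = inner x (A y)"
    and gap: "\<And>c u. u \<noteq> 0 \<Longrightarrow> A u = c *\<^sub>R u \<Longrightarrow> c \<noteq> 0 \<Longrightarrow> b < c"
    and c: "0 < c" "c \<le> b"
  shows "bij (op_shift A c)"
proof -
  have "x = 0" if "op_shift A c x = 0" for x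
    using that gap[of x c] c by (force simp: op_shift_def)
  then have "inj (op_shift A c)"
    using linear_injective_0[OF linear_op_shift[OF lin]] by blast
  then show ?thesis
    using linear_injective_imp_surjective[OF linear_op_shift[OF lin]] by (simp add: bij_def)
qed

text \<open>The inequality \<open>N\<^sup>2 \<le> 2 M N\<close>, tested on \<open>(A - b I) (A - (b - \<delta>) I) y\<close> so that no inverses occur.
  The difference of the two sides is \<open>\<parallel>(A - b I) y\<parallel>\<^sup>2 + 2 \<delta> \<langle>(A - b I) y, y\<rangle>\<close>, in which the kernel
  component of \<open>y\<close> contributes \<open>b (b - 2 \<delta>)\<close> times its squared norm.\<close>

lemma shift_square_le:
  fixes A :: "'a::euclidean_space \<Rightarrow> 'a"
  assumes lin: "linear A" and sym: "\<And>x y. inner (A x) y = inner x (A y)"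
    and gap: "\<And>c u. u \<noteq> 0 \<Longrightarrow> A u = c *\<^sub>R u \<Longrightarrow> c \<noteq> 0 \<Longrightarrow> b < c"
    and \<delta>: "0 < \<delta>" "2 * \<delta> \<le> b"
  shows "(norm (op_shift A b y))\<^sup>2 \<le> 2 * inner (op_shift A b y) (op_shift A (b - \<delta>) y)"
proof -
  obtain k r where y: "y = k + r" and k: "A k = 0" and orth: "\<And>z. A z = 0 \<Longrightarrow> inner z r = 0"
    and pos: "r \<noteq> 0 \<Longrightarrow> b * (norm r)\<^sup>2 < inner (A r) r"
    by (rule spectral_gap_decomp[OF lin sym gap, where x = y]) blast+
  have kr: "inner k r = 0" "inner r k = 0" using orth[OF k] by (simp_all add: inner_commute)
  have kAr: "inner k (A r) = 0" "inner (A r) k = 0" using sym[of k r] k by (simp_all add: inner_commute)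
  define s where "s = A r - b *\<^sub>R r"
  have r: "0 \<le> inner s r"
    using pos by (cases "r = 0") (auto simp: s_def inner_diff_left power2_norm_eq_inner)
  have ks: "inner k s = 0" "inner s k = 0"
    using kr kAr by (simp_all add: s_def inner_diff_left inner_diff_right)
  have b: "op_shift A b y = s - b *\<^sub>R k"
    by (simp add: op_shift_def y s_def linear_add[OF lin] k algebra_simps)
  have b': "op_shift A (b - \<delta>) y = s - b *\<^sub>R k + \<delta> *\<^sub>R (k + r)"
    by (simp add: op_shift_def y s_def linear_add[OF lin] k algebra_simps)
  have "2 * inner (op_shift A b y) (op_shift A (b - \<delta>) y) - (norm (op_shift A b y))\<^sup>2
      = inner s s + b * (b - 2 * \<delta>) * inner k k + 2 * \<delta> * inner s r"
    unfolding b b' power2_norm_eq_inner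
    by (simp add: inner_diff_left inner_diff_right inner_add_left inner_add_right ks kr algebra_simps)
  also have "\<dots> \<ge> 0" using r \<delta> by (intro add_nonneg_nonneg mult_nonneg_nonneg) auto
  finally show ?thesis by simp
qed

section \<open>Inverses of shifted operators\<close>

lemma inner_inv_sym:
  assumes "bij S" and sym: "\<And>x y. inner (S x) y = inner x (S y)"
  shows "inner (Hilbert_Choice.inv S x) y = inner x (Hilbert_Choice.inv S y)"
  using sym[of "Hilbert_Choice.inv S x" "Hilbert_Choice.inv S y"] \<open>bij S\<close>
  by (simp add: bij_is_surj surj_f_inv_f)

text \<open>The resolvent identity \<open>M - N = \<delta> M N\<close> turns \<open>N\<^sup>2 \<le> 2 M N\<close> into the bound
  \<open>N\<^sup>2 \<le> (2 / \<delta>) (M - N)\<close>.\<close>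

lemma resolvent_square_le:
  fixes A :: "'a::euclidean_space \<Rightarrow> 'a"
  assumes lin: "linear A" and sym: "\<And>x y. inner (A x) y = inner x (A y)"
    and gap: "\<And>c u. u \<noteq> 0 \<Longrightarrow> A u = c *\<^sub>R u \<Longrightarrow> c \<noteq> 0 \<Longrightarrow> b < c"
    and \<delta>: "0 < \<delta>" "2 * \<delta> \<le> b"
  shows "\<delta> / 2 * (norm (Hilbert_Choice.inv (op_shift A (b - \<delta>)) w))\<^sup>2
    \<le> inner (Hilbert_Choice.inv (op_shift A b) w) w
      - inner (Hilbert_Choice.inv (op_shift A (b - \<delta>)) w) w"
proof -
  let ?S = "op_shift A b" and ?T = "op_shift A (b - \<delta>)"
  have bij: "bij ?S" "bij ?T"
    using \<delta> by (intro bij_op_shift_spectral_gap[OF lin sym gap]; simp)+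
  define x where "x = Hilbert_Choice.inv ?T w"
  define y where "y = Hilbert_Choice.inv ?S x"
  have w: "w = ?T x" and x: "x = ?S y"
    using bij by (simp_all add: x_def y_def bij_is_surj surj_f_inv_f)
  have "?S (x + \<delta> *\<^sub>R y) = ?S x + \<delta> *\<^sub>R ?S y"
    using linear_op_shift[OF lin] by (simp add: linear_add linear_scale)
  also have "\<dots> = w"
    unfolding x[symmetric] w by (simp add: op_shift_def algebra_simps)
  finally have Mw: "Hilbert_Choice.inv ?S w = x + \<delta> *\<^sub>R y"
    using bij by (metis bij_is_inj inv_f_f)
  have "(norm x)\<^sup>2 \<le> 2 * inner x (?T y)"
    using shift_square_le[OF lin sym gap \<delta>, where y = y] x by simp
  also have "inner x (?T y) = inner y w"
    using sym[of y x] by (simp add: w op_shift_def inner_diff_left inner_diff_right inner_commute)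
  finally have "\<delta> / 2 * (norm x)\<^sup>2 \<le> \<delta> / 2 * (2 * inner y w)"
    using \<delta> by (intro mult_left_mono) auto
  then show ?thesis
    unfolding Mw x_def[symmetric] by (simp add: inner_add_left)
qed

text \<open>On the orthogonal complement of the kernel of \<open>A\<close> the operator \<open>A - c I\<close> is positive definite,
  and \<open>(A - c I)\<^sup>-\<^sup>1\<close> maps this complement into itself.\<close>

lemma resolvent_nonneg_ortho_kernel:
  fixes A :: "'a::euclidean_space \<Rightarrow> 'a"
  assumes lin: "linear A" and sym: "\<And>x y. inner (A x) y = inner x (A y)"
    and gap: "\<And>c u. u \<noteq> 0 \<Longrightarrow> A u = c *\<^sub>R u \<Longrightarrow> c \<noteq> 0 \<Longrightarrow> b < c"
    and c: "0 < c" "c \<le> b"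
    and w: "\<And>k. A k = 0 \<Longrightarrow> inner k w = 0"
  shows "0 \<le> inner (Hilbert_Choice.inv (op_shift A c) w) w"
proof -
  define x where "x = Hilbert_Choice.inv (op_shift A c) w"
  have "op_shift A c x = w"
    unfolding x_def by (rule surj_f_inv_f[OF bij_is_surj[OF bij_op_shift_spectral_gap[OF lin sym gap c]]])
  then have wx: "w = A x - c *\<^sub>R x" by (simp add: op_shift_def)
  have orth: "inner k x = 0" if "A k = 0" for k
  proof -
    have "inner k (A x) = 0" using that by (simp flip: sym)
    then show ?thesis using w[OF that] c by (simp add: wx inner_diff_right)
  qed
  show ?thesis
  proof (cases "x = 0")
    case False
    have "c * inner x x \<le> b * inner x x" using c by (intro mult_right_mono) auto
    also have "\<dots> < inner (A x) x"
      using spectral_gap_ortho_kernel[OF lin sym gap orth False] by (simp add: power2_norm_eq_inner)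
    finally show ?thesis
      unfolding x_def[symmetric] by (simp add: wx inner_diff_right inner_commute)
  qed (simp flip: x_def)
qed

text \<open>The Sherman--Morrison formula.\<close>

lemma rank_one_update:
  fixes S :: "'a::euclidean_space \<Rightarrow> 'a"
  assumes lin: "linear S" and bij: "bij S"
    and nz: "1 + inner (Hilbert_Choice.inv S w) w \<noteq> 0"
  shows bij_rank_one_update: "bij (\<lambda>x. S x + rank_one w x)"
    and inv_rank_one_update: "Hilbert_Choice.inv (\<lambda>x. S x + rank_one w x) y =
      Hilbert_Choice.inv S y
      - (inner (Hilbert_Choice.inv S y) w / (1 + inner (Hilbert_Choice.inv S w) w))
        *\<^sub>R Hilbert_Choice.inv S w"
proof -
  let ?U = "\<lambda>x. S x + rank_one w x" and ?N = "Hilbert_Choice.inv S"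
  have SN: "S (?N z) = z" for z using bij by (simp add: bij_is_surj surj_f_inv_f)
  have linU: "linear ?U"
    using lin by (auto simp: rank_one_def linear_iff inner_add_left algebra_simps)
  have "x = 0" if "?U x = 0" for x
  proof -
    have "S (x + inner x w *\<^sub>R ?N w) = S 0"
      using that by (simp add: linear_add[OF lin] linear_scale[OF lin] linear_0[OF lin] SN rank_one_def)
    then have x: "x + inner x w *\<^sub>R ?N w = 0"
      using bij by (meson bij_is_inj injD)
    then have "inner (x + inner x w *\<^sub>R ?N w) w = 0" by simp
    then have "inner x w * (1 + inner (?N w) w) = 0"
      by (simp add: inner_add_left algebra_simps)
    with nz have "inner x w = 0" by simp
    with x show ?thesis by simp
  qed
  then have inj: "inj ?U" using linear_injective_0[OF linU] by blast
  then show "bij ?U" using linear_injective_imp_surjective[OF linU] by (simp add: bij_def)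
  define d where "d = 1 + inner (?N w) w"
  define t where "t = inner (?N y) w / d"
  have "t * d = inner (?N y) w" using nz by (simp add: t_def d_def)
  then have "inner (?N y) w - t * inner (?N w) w = t" by (simp add: d_def algebra_simps)
  then have "?U (?N y - t *\<^sub>R ?N w) = y"
    by (simp add: linear_diff[OF lin] linear_scale[OF lin] SN rank_one_def inner_diff_left)
  then show "Hilbert_Choice.inv ?U y = ?N y - (inner (?N y) w / (1 + inner (?N w) w)) *\<^sub>R ?N w"
    unfolding t_def d_def by (rule inv_f_eq[OF inj])
qed

text \<open>The Sherman--Morrison formula after taking the trace: the rank-one correction becomes
  \<open>\<parallel>L\<^sup>T N w\<parallel>\<^sup>2\<close>, by Parseval's identity.\<close>

lemma op_trace_rank_one_update:
  fixes S L :: "'a::euclidean_space \<Rightarrow> 'a"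
  assumes basis: "orthonormal_basis n v" and L: "linear L" and lin: "linear S" and bij: "bij S"
    and sym: "\<And>x y. inner (S x) y = inner x (S y)"
    and nz: "1 + inner (Hilbert_Choice.inv S w) w \<noteq> 0"
  shows "op_trace n v (adjoint L \<circ> Hilbert_Choice.inv (\<lambda>x. S x + rank_one w x) \<circ> L)
    = op_trace n v (adjoint L \<circ> Hilbert_Choice.inv S \<circ> L)
      - (norm (adjoint L (Hilbert_Choice.inv S w)))\<^sup>2 / (1 + inner (Hilbert_Choice.inv S w) w)"
proof -
  let ?N = "Hilbert_Choice.inv S"
  define d where "d = 1 + inner (?N w) w"
  have summand: "inner (Hilbert_Choice.inv (\<lambda>x. S x + rank_one w x) (L z)) (L z)
      = inner (?N (L z)) (L z) - (inner (adjoint L (?N w)) z)\<^sup>2 / d" for z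
  proof -
    have "inner (?N w) (L z) = inner (adjoint L (?N w)) z"
      using adjoint_works[OF L, of z "?N w"] by (simp add: inner_commute)
    moreover have "inner (?N (L z)) w = inner (?N w) (L z)"
      using inner_inv_sym[OF bij sym, of "L z" w] by (simp add: inner_commute)
    ultimately show ?thesis
      by (simp add: inv_rank_one_update[OF lin bij nz] inner_diff_left power2_eq_square d_def)
  qed
  show ?thesis
    unfolding op_trace_conj[OF L] summand sum_subtractf d_def[symmetric]
    by (simp only: orthonormal_basis_parseval[OF basis] flip: sum_divide_distrib)
qed

section \<open>The barrier step\<close>

theorem theorem2p1:
  fixes L A :: "'a::euclidean_space \<Rightarrow> 'a"
    and v :: "nat \<Rightarrow> 'a"
    and n m :: nat
    and b b' \<delta> :: real
  assumes dim: "DIM('a) = n"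
    and basis: "orthonormal_basis n v"
    and lin: "linear L"
    and unit: "\<And>i. i \<in> {1..n} \<Longrightarrow> norm (L (v i)) = 1"
    and m: "m \<le> n"
    and A: "A = (\<lambda>x. \<Sum>i = 1..m. rank_one (L (v i)) x)"
    and \<delta>: "\<delta> > 0"
    and b': "b' = b - \<delta>"
    and b'_gt: "b' > \<delta>"
    and card_eig: "size {#c \<in># op_eigenvalues n v A. c \<noteq> 0#} = m"
    and eig_gt: "\<And>c. c \<in># op_eigenvalues n v A \<Longrightarrow> c \<noteq> 0 \<Longrightarrow> c > b"
    and tr: "op_trace n v (adjoint L \<circ> Hilbert_Choice.inv (op_shift A b) \<circ> L)
               \<le> - real n - 2 * (onorm L)\<^sup>2 / \<delta>"
  shows "\<exists>\<omega> \<in> (\<lambda>i. L (v i)) ` {1..n}.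
           bij (op_shift A b') \<and>
           inner (Hilbert_Choice.inv (op_shift A b') \<omega>) \<omega> < - 1 \<and>
           (\<exists>j. m < j \<and> j \<le> n \<and> \<omega> = L (v j)) \<and>
           bij (op_shift (\<lambda>x. A x + rank_one \<omega> x) b') \<and>
           op_trace n v (adjoint L \<circ> Hilbert_Choice.inv (op_shift (\<lambda>x. A x + rank_one \<omega> x) b') \<circ> L)
             \<le> op_trace n v (adjoint L \<circ> Hilbert_Choice.inv (op_shift A b) \<circ> L) \<and>
           op_trace n v (adjoint L \<circ> Hilbert_Choice.inv (op_shift A b) \<circ> L)
             \<le> - real n - 2 * (onorm L)\<^sup>2 / \<delta>"
proof -
  let ?M = "Hilbert_Choice.inv (op_shift A b)" and ?N = "Hilbert_Choice.inv (op_shift A b')"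
  let ?w = "\<lambda>i. L (v i)"
  define TM where "TM = op_trace n v (adjoint L \<circ> ?M \<circ> L)"
  define TN where "TN = op_trace n v (adjoint L \<circ> ?N \<circ> L)"
  have linA: "linear A"
    unfolding A by (auto simp: rank_one_def linear_iff inner_add_left sum.distrib scaleR_sum_right
        algebra_simps)
  have symA: "inner (A x) y = inner x (A y)" for x y
    by (simp add: A rank_one_def inner_sum_left inner_sum_right inner_commute mult.commute)
  have gap: "b < c" if "u \<noteq> 0" "A u = c *\<^sub>R u" "c \<noteq> 0" for c u
    using eig_gt eigenvector_imp_op_eigenvalue[OF basis linA] that by blast
  have bb: "2 * \<delta> \<le> b" "0 < b'" "b' \<le> b" using b' b'_gt \<delta> by auto
  have bij: "bij (op_shift A b')" using bij_op_shift_spectral_gap[OF linA symA gap bb(2,3)] .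
  have symS: "inner (op_shift A b' x) y = inner x (op_shift A b' y)" for x y
    by (simp add: op_shift_def inner_diff_left inner_diff_right symA)
  have TM: "TM = (\<Sum>i=1..n. inner (?M (?w i)) (?w i))"
    and TN: "TN = (\<Sum>i=1..n. inner (?N (?w i)) (?w i))"
    by (simp_all only: TM_def TN_def op_trace_conj[OF lin])
  define s where "s = (\<Sum>i=1..n. (norm (?N (?w i)))\<^sup>2)"

  have \<Delta>_ge: "\<delta> / 2 * s \<le> TM - TN"
    unfolding s_def sum_distrib_left TM TN sum_subtractf[symmetric] b'
    by (intro sum_mono resolvent_square_le[OF linA symA gap \<delta> bb(1)])
  then have s_le: "s \<le> 2 / \<delta> * (TM - TN)"
    using \<delta> by (simp add: field_simps)
  have "0 < s"
  proof -
    have "1 \<in> {1..n}" using dim DIM_positive[where 'a='a] by simp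
    moreover from this have "?N (?w 1) \<noteq> 0"
      using unit[of 1] bij surj_f_inv_f[OF bij_is_surj[OF bij], of "?w 1"]
        linear_0[OF linear_op_shift[OF linA]] by (metis norm_zero zero_neq_one)
    ultimately show ?thesis
      unfolding s_def by (intro sum_pos2[where i = 1]) auto
  qed
  then have "0 < \<delta> / 2 * s" using \<delta> by simp
  with \<Delta>_ge have \<Delta>: "0 < TM - TN" by linarith

  \<comment> \<open>If no index satisfied this, then summing the reverse inequalities would contradict the
    hypothesis on the trace.\<close>
  have "\<exists>i\<in>{1..n}. (norm (adjoint L (?N (?w i))))\<^sup>2 < (TM - TN) * (- 1 - inner (?N (?w i)) (?w i))"
  proof (rule ccontr)
    assume "\<not> ?thesis"
    then have "(\<Sum>i=1..n. (TM - TN) * (- 1 - inner (?N (?w i)) (?w i)))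
        \<le> (\<Sum>i=1..n. (norm (adjoint L (?N (?w i))))\<^sup>2)"
      by (intro sum_mono) (auto simp: not_less)
    also have "\<dots> \<le> (\<Sum>i=1..n. (onorm L * norm (?N (?w i)))\<^sup>2)"
      by (intro sum_mono power_mono norm_adjoint_le[OF lin]) auto
    also have "\<dots> = (onorm L)\<^sup>2 * s"
      by (simp add: s_def sum_distrib_left power_mult_distrib)
    also have "\<dots> \<le> (onorm L)\<^sup>2 * (2 / \<delta> * (TM - TN))"
      using s_le by (intro mult_left_mono) auto
    also have "(\<Sum>i=1..n. (TM - TN) * (- 1 - inner (?N (?w i)) (?w i))) = (TM - TN) * (- real n - TN)"
      by (simp add: sum_distrib_left[symmetric] sum_subtractf TN)
    also have "(onorm L)\<^sup>2 * (2 / \<delta> * (TM - TN)) = (TM - TN) * (2 * (onorm L)\<^sup>2 / \<delta>)"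
      by simp
    finally have "(TM - TN) * (- real n - TN) \<le> (TM - TN) * (2 * (onorm L)\<^sup>2 / \<delta>)" .
    then have "- real n - TN \<le> 2 * (onorm L)\<^sup>2 / \<delta>"
      using \<Delta> by (simp only: mult_le_cancel_left_pos)
    with tr \<Delta> show False by (simp add: TM_def)
  qed
  then obtain i where i: "i \<in> {1..n}"
    and less: "(norm (adjoint L (?N (?w i))))\<^sup>2 < (TM - TN) * (- 1 - inner (?N (?w i)) (?w i))"
    by blast
  define w where "w = ?w i"
  have "0 < (TM - TN) * (- 1 - inner (?N w) w)"
    using less unfolding w_def by (rule le_less_trans[OF zero_le_power2])
  then have neg: "inner (?N w) w < - 1"
    using \<Delta> by (simp add: zero_less_mult_iff)
  then have nz: "1 + inner (?N w) w \<noteq> 0" by simp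

  have "m < i"
  proof (rule ccontr)
    assume "\<not> m < i"
    then have im: "i \<in> {1..m}" using i by simp
    \<comment> \<open>As \<open>w\<close> is one of the \<open>m\<close> vectors that make up \<open>A\<close>, the square \<open>\<langle>k, w\<rangle>\<^sup>2\<close> is one of the
      nonnegative terms that add up to \<open>\<langle>A k, k\<rangle>\<close>.\<close>
    have "inner k w = 0" if "A k = 0" for k
    proof -
      have "(\<Sum>j=1..m. (inner k (?w j))\<^sup>2) = inner (A k) k"
        by (simp add: A rank_one_def inner_sum_left power2_eq_square inner_commute[of k])
      also have "\<dots> = 0" using that by simp
      finally show ?thesis using im by (simp add: sum_nonneg_eq_0_iff w_def)
    qed
    from resolvent_nonneg_ortho_kernel[OF linA symA gap bb(2,3) this] neg show False by simp
  qed

  have shift: "op_shift (\<lambda>x. A x + rank_one w x) b' = (\<lambda>x. op_shift A b' x + rank_one w x)"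
    by (simp add: op_shift_def fun_eq_iff)
  have bij': "bij (op_shift (\<lambda>x. A x + rank_one w x) b')"
    unfolding shift by (rule bij_rank_one_update[OF linear_op_shift[OF linA] bij nz])
  have "op_trace n v (adjoint L \<circ> Hilbert_Choice.inv (op_shift (\<lambda>x. A x + rank_one w x) b') \<circ> L)
      = TN + (norm (adjoint L (?N w)))\<^sup>2 / (- 1 - inner (?N w) w)"
    unfolding shift TN_def op_trace_rank_one_update[OF basis lin linear_op_shift[OF linA] bij symS nz]
    using minus_divide_right[of "(norm (adjoint L (?N w)))\<^sup>2" "1 + inner (?N w) w"] by simp
  also have "\<dots> \<le> TM"
  proof -
    have "(norm (adjoint L (?N w)))\<^sup>2 / (- 1 - inner (?N w) w) \<le> TM - TN"
      using less neg by (simp add: w_def pos_divide_le_eq)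
    then show ?thesis by simp
  qed
  finally have "op_trace n v
      (adjoint L \<circ> Hilbert_Choice.inv (op_shift (\<lambda>x. A x + rank_one w x) b') \<circ> L) \<le> TM" .
  with i neg \<open>m < i\<close> bij bij' tr show ?thesis
    unfolding TM_def w_def by (intro bexI[of _ "?w i"]) auto
qed

end
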